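(* Let $\{p_s\}_{s\in S}$ be an arbitrary non-empty collection of regular quasi-values on an Abelian group $G$. Then its pointwise supremum, that is, the function $\bigvee_{s\in S}p_s$ given by the formula $$\Big(\bigvee_{s\in S}p_s\Big)(g)=\sup_{s\in S}p_s(g)\qquad(g\in G),$$ is a regular quasi-value as well.
   Context: All groups are Abelian, written multiplicatively and endowed with no topology. $\mathbb{T}=\{z\in\mathbb{C}:|z|=1\}$ and $\lambda(z)=\min\{|t|: t\in\mathbb{R},\ e^{2\pi t i}=z\}$ for $z\in\mathbb{T}$. $G^{\#}$ is the group of all homomorphisms from $G$ into $\mathbb{T}$, $G^{\#\#}=(G^{\#})^{\#}$, and for $x\in G$, $\mathfrak{e}_x\in G^{\#\#}$ is given by $\mathfrak{e}_x(\chi)=\chi(x)$. A quasi-value on $G$ is a function $p\colon G\to[0,\infty]$ with $p(e_G)=0$, $p(x^{-1})=p(x)$ and $p(xy)\le p(x)+p(y)$ for all $x,y\in G$. Its dual quasi-value on $G^{\#}$ is $p^{\#}(\chi)=\sup\{\lambda(\chi(g))/p(g):\ g\in G,\ \chi(g)\neq1\}$, with conventions $\sup(\varnothing)=0$, $a/0=\infty$, $a/\infty=0$ for $a\in(0,\infty)$. Put $p^{\#\#}=(p^{\#})^{\#}$ (a quasi-value on $G^{\#\#}$). The regularisation of $p$ is the quasi-value $p_{\mathrm{reg}}(x)=p^{\#\#}(\mathfrak{e}_x)$ on $G$. The quasi-value $p$ is regular if $p=p_{\mathrm{reg}}$. *)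

theory Defs
  imports Complex_Main "HOL-Algebra.Group" "HOL-Library.Extended_Nonnegative_Real"
begin

text \<open>Quasi-values take values in \<^typ>\<open>ennreal\<close>, that is, in \<open>[0,\<infinity>]\<close>.\<close>

definition circle_group :: "complex monoid" where
  "circle_group = \<lparr>carrier = {z. norm z = 1}, mult = (*), one = 1\<rparr>"

definition lam :: "complex \<Rightarrow> real" where
  "lam z = (LEAST r. \<exists>t::real. exp (2 * of_real pi * of_real t * \<i>) = z \<and> r = \<bar>t\<bar>)"

text \<open>Homomorphisms are normalised to be \<open>undefined\<close> off the carrier, so that equality of
  characters is equality on the group.\<close>

definition dual_group :: "('a, 'm) monoid_scheme \<Rightarrow> ('a \<Rightarrow> complex) monoid" where
  "dual_group G =
    \<lparr>carrier = hom G circle_group \<inter> extensional (carrier G),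
     mult = (\<lambda>\<chi> \<psi>. \<lambda>x\<in>carrier G. \<chi> x * \<psi> x),
     one = (\<lambda>x\<in>carrier G. 1)\<rparr>"

definition eval_char :: "('a, 'm) monoid_scheme \<Rightarrow> 'a \<Rightarrow> ('a \<Rightarrow> complex) \<Rightarrow> complex" where
  "eval_char G x = (\<lambda>\<chi>\<in>carrier (dual_group G). \<chi> x)"

definition quasi_value :: "('a, 'm) monoid_scheme \<Rightarrow> ('a \<Rightarrow> ennreal) \<Rightarrow> bool" where
  "quasi_value G p \<longleftrightarrow>
    p \<one>\<^bsub>G\<^esub> = 0 \<and>
    (\<forall>x\<in>carrier G. p (inv\<^bsub>G\<^esub> x) = p x) \<and>
    (\<forall>x\<in>carrier G. \<forall>y\<in>carrier G. p (x \<otimes>\<^bsub>G\<^esub> y) \<le> p x + p y)"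

text \<open>The conventions \<open>sup \<emptyset> = 0\<close>, \<open>a / 0 = \<infinity>\<close> and \<open>a / \<infinity> = 0\<close> for \<open>0 < a < \<infinity>\<close> are those of
  \<^typ>\<open>ennreal\<close>; see \<open>ennreal_conventions\<close> below.\<close>

definition dual_qv ::
  "('a, 'm) monoid_scheme \<Rightarrow> ('a \<Rightarrow> ennreal) \<Rightarrow> ('a \<Rightarrow> complex) \<Rightarrow> ennreal" where
  "dual_qv G p \<chi> = (SUP g\<in>{g \<in> carrier G. \<chi> g \<noteq> 1}. ennreal (lam (\<chi> g)) / p g)"

definition regularisation :: "('a, 'm) monoid_scheme \<Rightarrow> ('a \<Rightarrow> ennreal) \<Rightarrow> 'a \<Rightarrow> ennreal" where
  "regularisation G p x = dual_qv (dual_group G) (dual_qv G p) (eval_char G x)"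

definition regular_quasi_value :: "('a, 'm) monoid_scheme \<Rightarrow> ('a \<Rightarrow> ennreal) \<Rightarrow> bool" where
  "regular_quasi_value G p \<longleftrightarrow>
    quasi_value G p \<and> (\<forall>x\<in>carrier G. p x = regularisation G p x)"

lemma ennreal_conventions:
  "Sup {} = (0::ennreal)"
  "0 < (a::ennreal) \<Longrightarrow> a / 0 = \<infinity>"
  "(a::ennreal) < \<infinity> \<Longrightarrow> a / \<infinity> = 0"
  by (auto simp: bot_ennreal divide_ennreal_def ennreal_mult_top)

text \<open>The minimum defining \<^const>\<open>lam\<close> is attained.\<close>

lemma lam_attained:
  assumes "norm z = 1"
  shows "\<exists>t::real. exp (2 * of_real pi * of_real t * \<i>) = z \<and> lam z = \<bar>t\<bar>"
    and "exp (2 * of_real pi * of_real t * \<i>) = z \<Longrightarrow> lam z \<le> \<bar>t\<bar>"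
proof -
  define t0 where "t0 = Arg z / (2 * pi)"
  have z0: "z \<noteq> 0" using assms by auto
  have e: "exp (2 * of_real pi * of_real t * \<i>) = cis (2 * pi * t)" for t
    by (simp add: cis_conv_exp mult_ac)
  have t0: "exp (2 * of_real pi * of_real t0 * \<i>) = z"
    using cis_Arg[OF z0] assms unfolding e t0_def by (simp add: sgn_div_norm)
  have b: "- 1 / 2 < t0" "t0 \<le> 1 / 2"
    using Arg_bounded[of z] unfolding t0_def by (auto simp: field_simps)
  have min: "\<bar>t0\<bar> \<le> \<bar>t\<bar>" if "exp (2 * of_real pi * of_real t * \<i>) = z" for t :: real
  proof -
    have "cis (2 * pi * t - 2 * pi * t0) = 1"
      using that t0 z0 unfolding e by (simp flip: cis_divide)
    hence "cos (2 * pi * t - 2 * pi * t0) = 1" by (metis cis.sel(1) one_complex.sel(1))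
    then obtain n :: int where "2 * pi * t - 2 * pi * t0 = of_int n * 2 * pi"
      unfolding cos_one_2pi_int by auto
    hence "2 * pi * (t - t0) = 2 * pi * of_int n" by (simp add: algebra_simps)
    hence n: "t = t0 + of_int n" by simp
    consider "n = 0" | "n \<ge> 1" | "n \<le> - 1" by linarith
    thus ?thesis
    proof cases
      case 2
      hence "real_of_int n \<ge> 1" by simp
      thus ?thesis using n b by linarith
    next
      case 3
      hence "real_of_int n \<le> - 1" by linarith
      thus ?thesis using n b by linarith
    qed (simp add: n)
  qed
  have l: "lam z = \<bar>t0\<bar>"
    unfolding lam_def by (rule Least_equality) (use t0 min in auto)
  show "\<exists>t::real. exp (2 * of_real pi * of_real t * \<i>) = z \<and> lam z = \<bar>t\<bar>"
    using t0 l by blast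
  show "exp (2 * of_real pi * of_real t * \<i>) = z \<Longrightarrow> lam z \<le> \<bar>t\<bar>"
    using min l by simp
qed

lemma comm_group_circle_group: "comm_group circle_group"
proof (rule comm_groupI)
  fix x assume x: "x \<in> carrier circle_group"
  hence "inverse x * x = 1" by (auto simp: circle_group_def intro: left_inverse)
  moreover have "inverse x \<in> carrier circle_group"
    using x by (simp add: circle_group_def norm_inverse)
  ultimately show "\<exists>y\<in>carrier circle_group. y \<otimes>\<^bsub>circle_group\<^esub> x = \<one>\<^bsub>circle_group\<^esub>"
    by (auto simp: circle_group_def)
qed (auto simp: circle_group_def norm_mult)

lemma comm_group_dual_group:
  assumes "comm_group G"
  shows "comm_group (dual_group G)"
proof -
  interpret comm_group G by fact
  show ?thesis
  proof (rule comm_groupI)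
    fix \<chi> assume c: "\<chi> \<in> carrier (dual_group G)"
    let ?i = "\<lambda>x\<in>carrier G. inverse (\<chi> x)"
    have nz: "\<chi> x \<noteq> 0" if "x \<in> carrier G" for x
    proof -
      have "norm (\<chi> x) = 1"
        using c that by (auto simp: dual_group_def circle_group_def hom_def Pi_iff)
      thus ?thesis by auto
    qed
    have "?i \<in> carrier (dual_group G)"
      using c by (auto simp: dual_group_def circle_group_def hom_def norm_inverse Pi_iff)
    moreover have "?i \<otimes>\<^bsub>dual_group G\<^esub> \<chi> = \<one>\<^bsub>dual_group G\<^esub>"
      using nz by (auto simp: dual_group_def fun_eq_iff)
    ultimately show "\<exists>\<psi>\<in>carrier (dual_group G). \<psi> \<otimes>\<^bsub>dual_group G\<^esub> \<chi> = \<one>\<^bsub>dual_group G\<^esub>" by blast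
  qed (auto simp: dual_group_def circle_group_def hom_def Pi_iff norm_mult fun_eq_iff
        extensional_def)
qed

lemma eval_char_in_bidual:
  assumes "comm_group G" "x \<in> carrier G"
  shows "eval_char G x \<in> carrier (dual_group (dual_group G))"
proof -
  interpret D: comm_group "dual_group G" using assms(1) by (rule comm_group_dual_group)
  have "\<chi> x \<in> carrier circle_group" if "\<chi> \<in> carrier (dual_group G)" for \<chi>
    using that assms(2) by (auto simp: dual_group_def hom_def)
  moreover have "(\<chi> \<otimes>\<^bsub>dual_group G\<^esub> \<psi>) x = \<chi> x * \<psi> x" for \<chi> \<psi>
    using assms(2) by (simp add: dual_group_def)
  ultimately have "eval_char G x \<in> hom (dual_group G) circle_group"
    by (auto simp: eval_char_def hom_def circle_group_def)
  thus ?thesis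
    unfolding dual_group_def[of "dual_group G"] by (simp add: eval_char_def)
qed

end

theory Submission
  imports Defs
begin

text \<open>
  The fixed points of a monotone operator that lies below the identity are closed under suprema,
  and regularisation is such an operator. Monotonicity holds because regularisation dualises
  twice and dualising reverses the pointwise order. Moreover \<open>regularisation G p \<le> p\<close> on \<open>G\<close> for
  every function \<open>p\<close>: if \<open>\<chi> x \<noteq> 1\<close>, then \<open>lam (\<chi> x) / p x \<le> dual_qv G p \<chi>\<close> by definition of the
  dual, and \<open>p x\<close> and \<open>dual_qv G p \<chi>\<close> may be exchanged in this inequality
  (\<open>ennreal_divide_le_swap\<close>). Writing \<open>q\<close> for the supremum of the regular \<open>p\<^sub>s\<close>, each
  \<open>p\<^sub>s = regularisation G p\<^sub>s\<close> is at most \<open>regularisation G q\<close> by monotonicity, whence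
  \<open>q \<le> regularisation G q \<le> q\<close>.
\<close>

lemma lam_pos:
  assumes "norm z = 1" and "z \<noteq> 1"
  shows "0 < lam z"
  using lam_attained(1)[OF assms(1)] assms(2) by (metis abs_zero exp_zero mult_zero_left
      mult_zero_right of_real_0 zero_less_abs_iff)

lemma ennreal_inverse_antimono:
  fixes a b :: ennreal
  assumes "a \<le> b"
  shows "inverse b \<le> inverse a"
  using assms
  by (simp add: less_eq_ennreal.rep_eq inverse_ennreal.rep_eq ereal_inverse_antimono)

text \<open>
  This is where the conventions for division matter. For \<open>0 < a < \<infinity>\<close>, \<open>a / b \<le> c\<close> says that
  \<open>a \<le> b * c\<close>, provided that \<open>0 * \<infinity>\<close> is read as \<open>\<infinity>\<close>, and this condition is symmetric in
  \<open>b\<close> and \<open>c\<close>.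
\<close>

lemma ennreal_divide_le_swap:
  fixes a b c :: ennreal
  assumes "a / b \<le> c" and "0 < a" and "a < \<infinity>"
  shows "a / c \<le> b"
proof (cases "b = 0 \<or> b = \<infinity>")
  case True
  then show ?thesis
    using assms by (auto simp: divide_ennreal_def ennreal_mult_top ennreal_top_mult top_unique
        split: if_splits)
next
  case False
  have "a / c \<le> a / (a / b)"
    using assms(1) by (simp add: divide_ennreal_def ennreal_inverse_antimono mult_left_mono)
  also have "a / (a / b) = b"
  proof -
    obtain a' b' where "a = ennreal a'" "b = ennreal b'" "0 < a'" "0 < b'"
      using assms(2,3) False by (cases a; cases b) auto
    then show ?thesis by (simp add: divide_ennreal)
  qed
  finally show ?thesis .
qed

lemma dual_qv_antimono:
  assumes "\<And>g. g \<in> carrier G \<Longrightarrow> p g \<le> q g"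
  shows "dual_qv G q \<chi> \<le> dual_qv G p \<chi>"
  unfolding dual_qv_def divide_ennreal_def
  by (intro SUP_subset_mono mult_left_mono ennreal_inverse_antimono assms) auto

lemma regularisation_mono:
  assumes "\<And>g. g \<in> carrier G \<Longrightarrow> p g \<le> q g"
  shows "regularisation G p x \<le> regularisation G q x"
  unfolding regularisation_def by (intro dual_qv_antimono assms)

lemma regularisation_le:
  assumes x: "x \<in> carrier G"
  shows "regularisation G p x \<le> p x"
  unfolding regularisation_def dual_qv_def[of "dual_group G"]
proof (rule SUP_least)
  fix \<chi> assume "\<chi> \<in> {\<chi> \<in> carrier (dual_group G). eval_char G x \<chi> \<noteq> 1}"
  then have \<chi>: "\<chi> \<in> carrier (dual_group G)" and ev: "eval_char G x \<chi> = \<chi> x" and ne: "\<chi> x \<noteq> 1"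
    by (auto simp: eval_char_def)
  have "norm (\<chi> x) = 1"
    using \<chi> x by (auto simp: dual_group_def circle_group_def hom_def Pi_iff)
  then have pos: "0 < ennreal (lam (\<chi> x))"
    using ne by (simp add: lam_pos)
  have "ennreal (lam (\<chi> x)) / p x \<le> dual_qv G p \<chi>"
    unfolding dual_qv_def using x ne by (intro SUP_upper) simp
  then show "ennreal (lam (eval_char G x \<chi>)) / dual_qv G p \<chi> \<le> p x"
    unfolding ev using pos by (rule ennreal_divide_le_swap) simp
qed

lemma quasi_value_SUP:
  assumes "\<And>s. s \<in> S \<Longrightarrow> quasi_value G (p s)"
  shows "quasi_value G (\<lambda>g. SUP s\<in>S. p s g)"
  unfolding quasi_value_def
proof (intro conjI ballI)
  show "(SUP s\<in>S. p s \<one>\<^bsub>G\<^esub>) = 0"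
    using assms by (auto simp: quasi_value_def bot_ennreal intro!: antisym SUP_least)
next
  fix x assume "x \<in> carrier G"
  then show "(SUP s\<in>S. p s (inv\<^bsub>G\<^esub> x)) = (SUP s\<in>S. p s x)"
    using assms by (intro SUP_cong) (auto simp: quasi_value_def)
next
  fix x y assume xy: "x \<in> carrier G" "y \<in> carrier G"
  show "(SUP s\<in>S. p s (x \<otimes>\<^bsub>G\<^esub> y)) \<le> (SUP s\<in>S. p s x) + (SUP s\<in>S. p s y)"
  proof (rule SUP_least)
    fix s assume s: "s \<in> S"
    have "p s (x \<otimes>\<^bsub>G\<^esub> y) \<le> p s x + p s y"
      using assms[OF s] xy by (simp add: quasi_value_def)
    also have "\<dots> \<le> (SUP s\<in>S. p s x) + (SUP s\<in>S. p s y)"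
      using s by (intro add_mono SUP_upper)
    finally show "p s (x \<otimes>\<^bsub>G\<^esub> y) \<le> (SUP s\<in>S. p s x) + (SUP s\<in>S. p s y)" .
  qed
qed

theorem theorem5p3:
  fixes G :: "('a, 'm) monoid_scheme"
    and S :: "'s set"
    and p :: "'s \<Rightarrow> 'a \<Rightarrow> ennreal"
  assumes "comm_group G"
    and "S \<noteq> {}"
    and "\<And>s. s \<in> S \<Longrightarrow> regular_quasi_value G (p s)"
  shows "regular_quasi_value G (\<lambda>g. SUP s\<in>S. p s g)"
  unfolding regular_quasi_value_def
proof (intro conjI ballI antisym)
  show "quasi_value G (\<lambda>g. SUP s\<in>S. p s g)"
    using assms(3) by (intro quasi_value_SUP) (simp add: regular_quasi_value_def)
next
  fix x assume x: "x \<in> carrier G"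
  show "(SUP s\<in>S. p s x) \<le> regularisation G (\<lambda>g. SUP s\<in>S. p s g) x"
  proof (rule SUP_least)
    fix s assume s: "s \<in> S"
    then have "p s x = regularisation G (p s) x"
      using assms(3) x by (simp add: regular_quasi_value_def)
    also have "\<dots> \<le> regularisation G (\<lambda>g. SUP s\<in>S. p s g) x"
      using s by (intro regularisation_mono SUP_upper)
    finally show "p s x \<le> regularisation G (\<lambda>g. SUP s\<in>S. p s g) x" .
  qed
  show "regularisation G (\<lambda>g. SUP s\<in>S. p s g) x \<le> (SUP s\<in>S. p s x)"
    using x by (rule regularisation_le)
qed

end
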